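(* For $d$-dimensional polytopes $P\subset\mathbb{R}^d$ with $n$ vertices, an upper bound on the number of combinatorial types of hyperplane sections $P\cap H$ ($H$ ranging over all affine hyperplanes of $\mathbb{R}^d$) is $O(n^{2d+1}2^{d})$.
   Context: The combinatorial type of a polytope is the isomorphism class of its face lattice. The $O$-bound is understood as $n$ and $d$ vary. *)

theory Defs
  imports "HOL-Analysis.Analysis" "HOL-Analysis.Finite_Function_Topology"
begin

text \<open>
  The implied constant of the bound is uniform in the dimension, so the dimension must be a
  natural number that can be quantified inside a formula, not a type. All the spaces
  \<open>\<real>\<^sup>d\<close> are therefore realised inside the one real vector space of finitely supported
  real sequences, where \<open>convex hull\<close>, \<open>affine hull\<close>, \<open>polytope\<close>, \<open>(face_of)\<close> and
  \<open>(extreme_point_of)\<close> are the library's notions.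
\<close>

definition Rspace :: "nat \<Rightarrow> (nat \<Rightarrow>\<^sub>0 real) set" where
  "Rspace d = {x. Poly_Mapping.keys x \<subseteq> {..<d}}"

definition affine_hyperplane :: "nat \<Rightarrow> (nat \<Rightarrow>\<^sub>0 real) set \<Rightarrow> bool" where
  "affine_hyperplane d H \<longleftrightarrow>
     (\<exists>a b. a \<in> Rspace d \<and> a \<noteq> 0 \<and>
        H = {x \<in> Rspace d. (\<Sum>i<d. Poly_Mapping.lookup a i * Poly_Mapping.lookup x i) = b})"

text \<open>
  The library's \<^const>\<open>aff_dim\<close> is only available on Euclidean spaces; this is the property by
  which it is defined there, on an arbitrary real vector space.
\<close>

definition has_aff_dim :: "'a::real_vector set \<Rightarrow> nat \<Rightarrow> bool" where
  "has_aff_dim S k \<longleftrightarrow>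
     (\<exists>B. affine hull B = affine hull S \<and> \<not> affine_dependent B \<and> finite B \<and> card B = k + 1)"

lemma has_aff_dim_iff_aff_dim:
  fixes S :: "'a::euclidean_space set"
  shows "has_aff_dim S k \<longleftrightarrow> aff_dim S = int k"
proof
  assume "has_aff_dim S k"
  then obtain B where B: "affine hull B = affine hull S" "\<not> affine_dependent B" "card B = k + 1"
    unfolding has_aff_dim_def by blast
  then show "aff_dim S = int k"
    using aff_dim_unique[of B S] by simp
next
  assume dim: "aff_dim S = int k"
  obtain B where B: "affine hull B = affine hull S" "\<not> affine_dependent B"
    "int (card B) = aff_dim S + 1"
    using aff_dim_basis_exists by metis
  have "finite B" "card B = k + 1"
    using B dim aff_independent_finite by auto
  with B show "has_aff_dim S k"
    unfolding has_aff_dim_def by blast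
qed

definition vertices :: "'a::real_vector set \<Rightarrow> 'a set" where
  "vertices P = {v. v extreme_point_of P}"

text \<open>The face lattice, ordered by inclusion; it includes the empty face and \<open>P\<close> itself.\<close>

definition face_lattice :: "'a::real_vector set \<Rightarrow> 'a set set" where
  "face_lattice P = {F. F face_of P}"

text \<open>A bijection preserving and reflecting the order is the same as a lattice isomorphism.\<close>

definition face_lattice_isomorphic :: "'a::real_vector set \<Rightarrow> 'b::real_vector set \<Rightarrow> bool" where
  "face_lattice_isomorphic P Q \<longleftrightarrow>
     (\<exists>f. bij_betw f (face_lattice P) (face_lattice Q) \<and>
          (\<forall>F \<in> face_lattice P. \<forall>G \<in> face_lattice P. F \<subseteq> G \<longleftrightarrow> f F \<subseteq> f G))"

text \<open>
  The isomorphism class is represented by the set of all polytopes, in any \<open>\<real>\<^sup>d\<close>,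
  whose face lattice is isomorphic to that of \<open>P\<close>.
\<close>

definition combinatorial_type :: "(nat \<Rightarrow>\<^sub>0 real) set \<Rightarrow> (nat \<Rightarrow>\<^sub>0 real) set set" where
  "combinatorial_type P = {Q. polytope Q \<and> face_lattice_isomorphic P Q}"

definition section_types :: "nat \<Rightarrow> (nat \<Rightarrow>\<^sub>0 real) set \<Rightarrow> (nat \<Rightarrow>\<^sub>0 real) set set set" where
  "section_types d P = {combinatorial_type (P \<inter> H) | H. affine_hyperplane d H}"

end

theory Submission
  imports Defs
begin

text \<open>
  A nonempty face \<open>G\<close> of \<open>P \<inter> H\<close> is \<open>F \<inter> H\<close> for a unique face \<open>F\<close> of \<open>P\<close> whose relative interior
  meets \<open>H\<close>, and \<open>G\<close> determines \<open>F\<close> in an order-preserving way. The relative interior of \<open>F\<close> meets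
  \<open>H = {x. l x = b}\<close> iff \<open>l - b\<close> either vanishes at all vertices of \<open>F\<close> or takes both signs there.
  So the combinatorial type of \<open>P \<inter> H\<close> depends only on the signs of \<open>l - b\<close> at the vertices of \<open>P\<close>.
  These are the signs of \<open>n\<close> linear functionals at a point of the \<open>(d+1)\<close>-dimensional space of
  pairs \<open>(l, b)\<close>. A deletion-restriction recursion bounds their number by \<open>2 (2n)^(d+1)\<close>.
\<close>

section \<open>Sign patterns of linear functionals\<close>

text \<open>\<open>restrict\<close> makes two patterns equal as functions exactly when they agree on
  \<open>I\<close>, so that distinct patterns can be counted by \<open>card\<close>.\<close>

definition sign_pattern :: "('i \<Rightarrow> 'a \<Rightarrow> real) \<Rightarrow> 'i set \<Rightarrow> 'a \<Rightarrow> 'i \<Rightarrow> real" where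
  "sign_pattern g I w = restrict (\<lambda>i. sgn (g i w)) I"

lemma sign_pattern_eq_iff:
  "sign_pattern g I v = sign_pattern g I w \<longleftrightarrow> (\<forall>i\<in>I. sgn (g i v) = sgn (g i w))"
  by (auto simp: sign_pattern_def restrict_def fun_eq_iff)

lemma sign_pattern_insert:
  "sign_pattern g (insert j I) w = (sign_pattern g I w)(j := sgn (g j w))"
  by (auto simp: sign_pattern_def restrict_def fun_eq_iff)

text \<open>Used to stay inside a sign cell, which is a convex cone, when two of its points are
  combined.\<close>

lemma sgn_positive_combination:
  fixes a b r s :: real
  assumes "0 < a" "0 < b" "sgn r = sgn s"
  shows "sgn (a * r + b * s) = sgn r"
proof -
  consider "r > 0" "s > 0" | "r = 0" "s = 0" | "r < 0" "s < 0"
    using assms(3) by (auto simp: sgn_if split: if_splits)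
  then show ?thesis
  proof cases
    case 1
    then show ?thesis using assms by (simp add: add_pos_pos)
  next
    case 2
    then show ?thesis by simp
  next
    case 3
    then show ?thesis using assms by (simp add: add_neg_neg mult_pos_neg)
  qed
qed

text \<open>Projecting along a generator \<open>b\<close> outside the kernel of \<open>g\<close>
  fixes the kernel and sends \<open>b\<close> to 0, so the images of the other generators span the
  kernel part. The size of a finite spanning set takes the role of the dimension.\<close>

lemma span_Int_kernel_subset:
  fixes g :: "'a::real_vector \<Rightarrow> real"
  assumes "linear g" "finite B" "w \<in> span B" "g w \<noteq> 0"
  obtains B' where "finite B'" "card B' < card B" "span B \<inter> {x. g x = 0} = span B'"
proof -
  obtain b where b: "b \<in> B" "g b \<noteq> 0"
    using linear_eq_0_on_span[OF assms(1), of B w] assms(3,4) by blast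
  define p where "p x = x - (g x / g b) *\<^sub>R b" for x
  have lp: "linear p"
    using assms(1) by (auto simp: p_def linear_iff algebra_simps add_divide_distrib)
  have pb: "p b = 0"
    using b by (simp add: p_def)
  define B' where "B' = p ` (B - {b})"
  have "span B \<inter> {x. g x = 0} = p ` span B"
  proof
    show "span B \<inter> {x. g x = 0} \<subseteq> p ` span B"
      by (auto simp: p_def image_iff) (metis diff_zero div_0 scaleR_zero_left)
    show "p ` span B \<subseteq> span B \<inter> {x. g x = 0}"
      using b assms(1)
      by (auto simp: p_def linear_diff linear_cmul intro: span_diff span_scale span_base)
  qed
  also have "\<dots> = span (p ` B)"
    by (simp add: linear_span_image lp)
  also have "p ` B = insert 0 B'"
    using b pb by (auto simp: B'_def)
  also have "span (insert 0 B') = span B'"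
    by (simp add: span_insert_0)
  finally have "span B \<inter> {x. g x = 0} = span B'" .
  moreover have "card B' < card B"
    unfolding B'_def using assms(2) b(1)
    by (metis card_Diff1_less card_image_le finite_Diff order.strict_trans1)
  ultimately show thesis
    using that[of B'] assms(2) by (simp add: B'_def)
qed

text \<open>A pattern on \<open>I\<close> extends to \<open>j\<close> in several ways only if it
  occurs on the hyperplane \<open>g j = 0\<close>, and then there are at most two extra extensions.
  That hyperplane has fewer generators, so a bound \<open>T\<close> suffices if
  \<open>T n m + 2 * T n (m - 1) <= T (n + 1) m\<close>, as holds for
  \<open>2 * (2 * n) ^ m\<close>.\<close>

lemma sign_pattern_card_bound:
  fixes g :: "'i \<Rightarrow> 'a::real_vector \<Rightarrow> real"
  assumes "finite I" "I \<noteq> {}" "\<And>i. i \<in> I \<Longrightarrow> linear (g i)" "finite B" "card B \<le> m"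
  shows "finite (sign_pattern g I ` span B) \<and>
    card (sign_pattern g I ` span B) \<le> 2 * (2 * card I) ^ m"
  using assms
proof (induction I arbitrary: B m rule: finite_ne_induct)
  case (singleton j)
  have sub: "sign_pattern g {j} ` span B \<subseteq> (\<lambda>s. restrict (\<lambda>_. s) {j}) ` {-1, 0, 1}"
  proof
    fix p assume "p \<in> sign_pattern g {j} ` span B"
    then obtain w where "p = restrict (\<lambda>_. sgn (g j w)) {j}"
      by (auto simp: sign_pattern_def restrict_def fun_eq_iff)
    moreover have "sgn (g j w) \<in> {-1, 0, 1}"
      by (simp add: sgn_if)
    ultimately show "p \<in> (\<lambda>s. restrict (\<lambda>_. s) {j}) ` {-1, 0, 1}"
      by blast
  qed
  have fin: "finite (sign_pattern g {j} ` span B)"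
    by (rule finite_subset[OF sub]) simp
  show ?case
  proof (cases m)
    case 0
    then have "B = {}"
      using singleton by simp
    then show ?thesis
      by (simp add: 0)
  next
    case (Suc k)
    have "card (sign_pattern g {j} ` span B) \<le> card ((\<lambda>s. restrict (\<lambda>_. s) {j}) ` {-1, 0, 1::real})"
      by (rule card_mono[OF _ sub]) simp
    also have "\<dots> \<le> card {-1, 0, 1::real}"
      by (rule card_image_le) simp
    also have "\<dots> \<le> 4"
      by simp
    \<comment> \<open>For one functional and \<open>m = Suc k\<close>, the claimed bound
      \<open>2 * (2 * 1) ^ m\<close> is \<open>4 * 2 ^ k\<close>.\<close>
    also have "(4::nat) \<le> 4 * 2 ^ k"
      by simp
    finally show ?thesis
      using fin Suc by simp
  qed
next
  case (insert j I)
  let ?W = "span B"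
  define A where "A = sign_pattern g I ` ?W"
  \<comment> \<open>\<open>E s\<close> holds the patterns on \<open>I\<close> that can be extended
    by the sign \<open>s\<close> at \<open>j\<close>.\<close>
  define E where "E s = sign_pattern g I ` {w \<in> ?W. sgn (g j w) = s}" for s
  have lin: "linear (g i)" if "i \<in> insert j I" for i
    using insert.prems(1) that by blast
  have A: "finite A" "card A \<le> 2 * (2 * card I) ^ m"
    unfolding A_def using insert.IH[of B m] lin insert.prems by auto
  have EA: "E s \<subseteq> A" for s
    unfolding E_def A_def by auto
  have finE: "finite (E s)" for s
    using EA A(1) finite_subset by blast
  have cardIns: "card (insert j I) = Suc (card I)"
    using insert.hyps by simp
  have mono: "2 * (2 * card I) ^ m \<le> 2 * (2 * card (insert j I)) ^ m"
    unfolding cardIns by (intro mult_left_mono power_mono) auto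
  show ?case
  proof (cases "\<forall>w\<in>?W. g j w = 0")
    case True
    then have "sign_pattern g (insert j I) ` ?W = (\<lambda>s. s(j := 0)) ` A"
      by (auto simp: A_def sign_pattern_insert image_image)
    then show ?thesis
      using A(1) order_trans[OF card_image_le[OF A(1)] order_trans[OF A(2) mono]] by simp
  next
    case False
    then obtain w where "w \<in> ?W" "g j w \<noteq> 0"
      by blast
    then obtain B' where B': "finite B'" "card B' < card B" "?W \<inter> {x. g j x = 0} = span B'"
      using span_Int_kernel_subset[of "g j" B w] lin insert.prems(2) by auto
    obtain k where k: "m = Suc k"
      using B'(2) insert.prems(3) by (cases m) auto
    \<comment> \<open>On the hyperplane \<open>g j = 0\<close> the induction hypothesis applies with
      the smaller exponent \<open>k\<close>.\<close>
    have "E 0 = sign_pattern g I ` span B'"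
      unfolding E_def B'(3)[symmetric] by (simp add: sgn_eq_0_iff Int_def)
    moreover have "card B' \<le> k"
      using B'(2) insert.prems(3) k by simp
    ultimately have E0: "card (E 0) \<le> 2 * (2 * card I) ^ k"
      using insert.IH[of B' k] B'(1) lin by auto
    text \<open>A pattern realised on both sides of the new hyperplane is realised on it, by convexity.\<close>
    have "E 1 \<inter> E (-1) \<subseteq> E 0"
    proof
      fix s assume "s \<in> E 1 \<inter> E (-1)"
      then obtain u v where u: "u \<in> ?W" "sgn (g j u) = 1" "s = sign_pattern g I u"
        and v: "v \<in> ?W" "sgn (g j v) = -1" "s = sign_pattern g I v"
        unfolding E_def by auto
      then have pos: "0 < - g j v" "0 < g j u"
        by (auto simp: sgn_if split: if_splits)
      \<comment> \<open>Both weights are positive, and they make \<open>g j\<close> cancel at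
        \<open>x\<close>.\<close>
      define x where "x = (- g j v) *\<^sub>R u + g j u *\<^sub>R v"
      have gx: "g i x = (- g j v) * g i u + g j u * g i v" if "i \<in> insert j I" for i
        unfolding x_def using lin[OF that] by (simp only: linear_add linear_cmul real_scaleR_def)
      have "sgn (g i x) = sgn (g i u)" if "i \<in> I" for i
        using gx[of i] sgn_positive_combination[OF pos, of "g i u" "g i v"] that u(3) v(3)
          sign_pattern_eq_iff[of g I u v] by simp
      then have "s = sign_pattern g I x"
        using u(3) by (auto simp: sign_pattern_eq_iff)
      moreover have "x \<in> ?W"
        unfolding x_def using u v by (intro span_add span_scale)
      moreover have "sgn (g j x) = 0"
        using gx[of j] by simp
      ultimately show "s \<in> E 0"
        unfolding E_def by blast
    qed
    \<comment> \<open>Inclusion-exclusion: the union of \<open>E 1\<close> and \<open>E (-1)\<close>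
      lies in \<open>A\<close>, their intersection in \<open>E 0\<close>.\<close>
    then have "card (E 1) + card (E (-1)) \<le> card A + card (E 0)"
      using card_Un_Int[OF finE finE, of 1 "-1"] card_mono[OF A(1), of "E 1 \<union> E (-1)"] EA
        card_mono[OF finE[of 0]] by (metis Un_least add_mono)
    then have bnd: "card (E 0) + card (E 1) + card (E (-1)) \<le> card A + 2 * card (E 0)"
      by simp
    let ?X = "\<lambda>s. (\<lambda>p. p(j := s)) ` E s"
    have split: "sign_pattern g (insert j I) ` ?W \<subseteq> ?X 0 \<union> ?X 1 \<union> ?X (-1)"
    proof
      fix p assume "p \<in> sign_pattern g (insert j I) ` ?W"
      then obtain w where w: "w \<in> ?W" "p = (sign_pattern g I w)(j := sgn (g j w))"
        by (auto simp: sign_pattern_insert)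
      then have "p \<in> ?X (sgn (g j w))"
        unfolding E_def by blast
      then show "p \<in> ?X 0 \<union> ?X 1 \<union> ?X (-1)"
        by (cases "g j w" "0::real" rule: linorder_cases) auto
    qed
    have finX: "finite (?X 0 \<union> ?X 1 \<union> ?X (-1))"
      using finE by simp
    have "card (sign_pattern g (insert j I) ` ?W) \<le> card (?X 0 \<union> ?X 1 \<union> ?X (-1))"
      by (rule card_mono[OF finX split])
    also have "\<dots> \<le> card (?X 0) + card (?X 1) + card (?X (-1))"
      by (meson card_Un_le order_trans add_right_mono)
    also have "\<dots> \<le> card (E 0) + card (E 1) + card (E (-1))"
      by (intro add_mono card_image_le finE)
    also have "\<dots> \<le> card A + 2 * card (E 0)"
      by (rule bnd)
    also have "\<dots> \<le> 2 * (2 * card I) ^ m + 2 * (2 * (2 * card I) ^ k)"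
      using A(2) E0 by simp
    \<comment> \<open>The new factor \<open>2 * card I + 2\<close> is
      \<open>2 * card (insert j I)\<close>; enlarging the base of the power to the same number
      closes the recursion.\<close>
    also have "\<dots> = 2 * ((2 * card I + 2) * (2 * card I) ^ k)"
      by (simp add: k algebra_simps)
    also have "\<dots> \<le> 2 * ((2 * card I + 2) * (2 * card I + 2) ^ k)"
      by (intro mult_left_mono power_mono) auto
    also have "\<dots> = 2 * (2 * card (insert j I)) ^ m"
      by (simp add: k cardIns)
    finally show ?thesis
      using finite_subset[OF split finX] by blast
  qed
qed

section \<open>Faces of polytopes in real vector spaces\<close>

text \<open>In a generating set of least size no point lies in the hull of the others, so every
  point is extreme; conversely every extreme point of a hull is one of its generators.\<close>

lemma polytope_convex_hull_vertices:
  assumes "polytope P"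
  shows "finite (vertices P)" "P = convex hull (vertices P)"
proof -
  obtain V where V: "finite V" "P = convex hull V"
    and min: "\<And>U. finite U \<Longrightarrow> P = convex hull U \<Longrightarrow> card V \<le> card U"
    using assms ex_has_least_nat[of "\<lambda>V. finite V \<and> P = convex hull V" _ card]
    unfolding polytope_def by metis
  have "v extreme_point_of P" if "v \<in> V" for v
  proof -
    have "v \<notin> convex hull (V - {v})"
    proof
      assume "v \<in> convex hull (V - {v})"
      then have "P = convex hull (V - {v})"
        using V(2) that by (metis hull_redundant insert_Diff)
      then show False
        using min[of "V - {v}"] V(1) that by (metis card_Diff1_less finite_Diff not_less)
    qed
    then show ?thesis
      using extreme_point_of_convex_hull_insert[of "V - {v}" v] V that by (simp add: insert_absorb)
  qed
  then have "vertices P = V"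
    using extreme_point_of_convex_hull V(2) unfolding vertices_def by blast
  with V show "finite (vertices P)" "P = convex hull (vertices P)"
    by auto
qed

text \<open>The absorption property of faces in terms of weights. The degenerate cases
  \<open>a = b\<close> and \<open>t = 1\<close>, where there is no open segment to argue with, are
  included, which spares later case distinctions.\<close>

lemma face_of_combinationD:
  fixes a b :: "'a::real_vector"
  assumes "F face_of P" "a \<in> P" "b \<in> P" "0 < t" "t \<le> 1" "t *\<^sub>R a + (1 - t) *\<^sub>R b \<in> F"
  shows "a \<in> F"
proof (cases "a = b \<or> t = 1")
  case True
  then show ?thesis
    using assms(6) by (auto simp flip: scaleR_left_distrib)
next
  case False
  then have "t *\<^sub>R a + (1 - t) *\<^sub>R b \<in> open_segment a b"
    using assms(4,5) unfolding in_segment by (intro conjI exI[of _ "1 - t"]) auto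
  then show ?thesis
    using face_ofD[OF assms(1) _ assms(2,3,6)] by blast
qed

text \<open>Isolates one generator so that \<open>face_of_combinationD\<close> applies to it. The
  point \<open>q\<close> is the rest of the sum, renormalised; if \<open>w\<close> carries all the
  weight, \<open>q = w\<close> serves as a default.\<close>

lemma convex_combination_split:
  fixes V :: "'a::real_vector set"
  assumes "finite V" "\<forall>v\<in>V. 0 \<le> u v" "sum u V = 1" "w \<in> V"
  obtains q where "q \<in> convex hull V" "(\<Sum>v\<in>V. u v *\<^sub>R v) = u w *\<^sub>R w + (1 - u w) *\<^sub>R q" "u w \<le> 1"
proof -
  let ?R = "V - {w}"
  have sumR: "sum u ?R = 1 - u w"
    using assms by (simp add: sum_diff1)
  have le1: "u w \<le> 1"
    using sumR sum_nonneg[of ?R u] assms(2) by auto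
  have eq: "(\<Sum>v\<in>V. u v *\<^sub>R v) = u w *\<^sub>R w + (\<Sum>v\<in>?R. u v *\<^sub>R v)"
    using assms by (simp add: sum.remove)
  show thesis
  proof (cases "u w = 1")
    case True
    then have "\<forall>v\<in>?R. u v = 0"
      using sumR assms(1,2) sum_nonneg_eq_0_iff[of ?R u] by auto
    then show thesis
      using that[of w] True eq assms(4) by (simp add: hull_inc)
  next
    case False
    define q where "q = (\<Sum>v\<in>?R. (u v / (1 - u w)) *\<^sub>R v)"
    have "q \<in> convex hull V"
      unfolding q_def
    proof (rule convex_sum)
      show "(\<Sum>v\<in>?R. u v / (1 - u w)) = 1"
        using sumR False by (simp flip: sum_divide_distrib)
    qed (use assms le1 in \<open>auto simp: hull_inc\<close>)
    moreover have "(1 - u w) *\<^sub>R q = (\<Sum>v\<in>?R. u v *\<^sub>R v)"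
      using False by (simp add: q_def scaleR_right.sum)
    ultimately show thesis
      using that[of q] eq le1 by simp
  qed
qed

text \<open>A generator with positive weight in a representation of a point of \<open>F\<close> is
  absorbed by \<open>F\<close>, so only generators inside \<open>F\<close> contribute.\<close>

lemma face_of_convex_hull_generators:
  fixes V :: "'a::real_vector set"
  assumes "finite V" "F face_of convex hull V"
  shows "F = convex hull (V \<inter> F)"
proof
  show "convex hull (V \<inter> F) \<subseteq> F"
    using assms(2) by (meson face_of_imp_convex hull_minimal inf_le2)
  show "F \<subseteq> convex hull (V \<inter> F)"
  proof
    fix x assume x: "x \<in> F"
    then have "x \<in> convex hull V"
      using assms(2) face_of_imp_subset by blast
    then obtain u where u: "\<forall>v\<in>V. 0 \<le> u v" "sum u V = 1" "(\<Sum>v\<in>V. u v *\<^sub>R v) = x"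
      using convex_hull_finite[OF assms(1)] by auto
    have zero: "u v = 0" if v: "v \<in> V" "v \<notin> F" for v
    proof (rule ccontr)
      assume "u v \<noteq> 0"
      then have "0 < u v"
        using u(1) v by (simp add: order_less_le)
      moreover obtain q where "q \<in> convex hull V" "x = u v *\<^sub>R v + (1 - u v) *\<^sub>R q" "u v \<le> 1"
        using convex_combination_split[OF assms(1) u(1,2) v(1)] unfolding u(3) by blast
      ultimately have "v \<in> F"
        using face_of_combinationD[OF assms(2), of v q "u v"] x v(1) by (simp add: hull_inc)
      with v show False by simp
    qed
    have "sum u (V \<inter> F) = 1"
      using u(2) zero sum.mono_neutral_right[OF assms(1), of "V \<inter> F" u] by auto
    moreover have "(\<Sum>v\<in>V \<inter> F. u v *\<^sub>R v) = x"
      using u(3) zero sum.mono_neutral_right[OF assms(1), of "V \<inter> F" "\<lambda>v. u v *\<^sub>R v"] by auto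
    ultimately show "x \<in> convex hull (V \<inter> F)"
      using u(1) convex_sum[of "V \<inter> F" "convex hull (V \<inter> F)" u "\<lambda>v. v"] assms(1)
      by (auto simp: hull_inc)
  qed
qed

lemma finite_faces_of_convex_hull:
  fixes V :: "'a::real_vector set"
  assumes "finite V"
  shows "finite {F. F face_of convex hull V}"
proof (rule finite_subset)
  show "{F. F face_of convex hull V} \<subseteq> (\<lambda>U. convex hull U) ` Pow V"
    using face_of_convex_hull_generators[OF assms] by blast
qed (use assms in auto)

text \<open>An algebraic substitute for membership in the relative interior of a face.\<close>

definition inner_point :: "'a::real_vector set \<Rightarrow> 'a set \<Rightarrow> 'a \<Rightarrow> bool" where
  "inner_point P F x \<longleftrightarrow> x \<in> F \<and> (\<forall>F'. F' face_of P \<longrightarrow> x \<in> F' \<longrightarrow> F \<subseteq> F')"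

text \<open>Apart from \<open>x\<close> itself (\<open>t = 1\<close>), these are the points
  \<open>y\<close> whose segment to \<open>x\<close> can be prolonged beyond \<open>x\<close> within
  \<open>P\<close>. For \<open>x\<close> in a convex \<open>P\<close> this is the smallest face
  containing \<open>x\<close>.\<close>

definition minimal_face :: "'a::real_vector set \<Rightarrow> 'a \<Rightarrow> 'a set" where
  "minimal_face P x = {y \<in> P. \<exists>t q. 0 < t \<and> t \<le> 1 \<and> q \<in> P \<and> x = t *\<^sub>R y + (1 - t) *\<^sub>R q}"

lemma minimal_face_of:
  fixes P :: "'a::real_vector set"
  assumes "convex P" "x \<in> P"
  shows "minimal_face P x face_of P"
proof -
  \<comment> \<open>Nesting the two combinations gives \<open>a\<close> the weight
    \<open>t * s\<close> in \<open>x\<close>; the remaining mass, renormalised, is the point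
    \<open>r\<close> of \<open>P\<close>.\<close>
  have absorb: "a \<in> minimal_face P x"
    if y: "s *\<^sub>R a + (1 - s) *\<^sub>R b \<in> minimal_face P x" and a: "a \<in> P" "b \<in> P" and s: "0 < s" "s \<le> 1"
    for a b s
  proof -
    obtain t q where t: "0 < t" "t \<le> 1" "q \<in> P"
      and x: "x = t *\<^sub>R (s *\<^sub>R a + (1 - s) *\<^sub>R b) + (1 - t) *\<^sub>R q"
      using y unfolding minimal_face_def by blast
    show ?thesis
    proof (cases "t * s = 1")
      case True
      then have "t = 1" "s = 1"
        using t s by (smt (verit) mult_left_le mult_left_le_one_le)+
      then show ?thesis
        unfolding minimal_face_def using x a by (auto intro!: exI[of _ "1::real"])
    next
      case False
      then have ts: "0 < t * s" "t * s < 1"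
        using t s by (auto simp: order_less_le mult_le_one)
      define r where "r = (t * (1 - s) / (1 - t * s)) *\<^sub>R b + ((1 - t) / (1 - t * s)) *\<^sub>R q"
      have "r \<in> P"
        unfolding r_def
      proof (rule convexD[OF assms(1) a(2) t(3)])
        show "t * (1 - s) / (1 - t * s) + (1 - t) / (1 - t * s) = 1"
          using ts by (simp add: field_simps)
      qed (use t s ts in auto)
      moreover have "(1 - t * s) *\<^sub>R r = (t * (1 - s)) *\<^sub>R b + (1 - t) *\<^sub>R q"
        using ts by (simp add: r_def scaleR_right_distrib)
      then have "x = (t * s) *\<^sub>R a + (1 - t * s) *\<^sub>R r"
        by (simp add: x algebra_simps)
      ultimately show ?thesis
        unfolding minimal_face_def using ts a less_imp_le by blast
    qed
  qed
  have "convex (minimal_face P x)"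
    unfolding convex_alt
  proof (intro ballI allI impI)
    fix y z and s :: real
    assume y: "y \<in> minimal_face P x" and z: "z \<in> minimal_face P x" and s: "0 \<le> s \<and> s \<le> 1"
    obtain t p where t: "0 < t" "t \<le> 1" "p \<in> P" "x = t *\<^sub>R y + (1 - t) *\<^sub>R p" "y \<in> P"
      using y unfolding minimal_face_def by blast
    obtain r q where r: "0 < r" "r \<le> 1" "q \<in> P" "x = r *\<^sub>R z + (1 - r) *\<^sub>R q" "z \<in> P"
      using z unfolding minimal_face_def by blast
    \<comment> \<open>Weighting the two representations of \<open>x\<close> by
      \<open>(1 - s) * r\<close> and \<open>s * t\<close> puts \<open>y\<close> and \<open>z\<close>
      in the ratio \<open>1 - s\<close> to \<open>s\<close>; \<open>D\<close> is the total
      weight.\<close>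
    define D where "D = (1 - s) * r + s * t"
    have D: "0 < D" "r * t \<le> D"
    proof -
      have "D = r * t + (1 - s) * r * (1 - t) + s * t * (1 - r)"
        by (simp add: D_def algebra_simps)
      moreover have "0 \<le> (1 - s) * r * (1 - t)" "0 \<le> s * t * (1 - r)"
        using s t r by auto
      moreover have "0 < r * t"
        using t r by simp
      ultimately show "0 < D" "r * t \<le> D"
        by linarith+
    qed
    let ?m = "(1 - s) *\<^sub>R y + s *\<^sub>R z"
    have yP: "?m \<in> P"
      using convexD_alt[OF assms(1) t(5) r(5)] s by simp
    have eq: "D *\<^sub>R x = (r * t) *\<^sub>R ?m + ((1 - s) * r * (1 - t)) *\<^sub>R p + (s * t * (1 - r)) *\<^sub>R q"
    proof -
      have "D *\<^sub>R x = ((1 - s) * r) *\<^sub>R x + (s * t) *\<^sub>R x"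
        by (simp add: D_def scaleR_left_distrib)
      also have "((1 - s) * r) *\<^sub>R x = ((1 - s) * r) *\<^sub>R (t *\<^sub>R y + (1 - t) *\<^sub>R p)"
        using t(4) by simp
      also have "(s * t) *\<^sub>R x = (s * t) *\<^sub>R (r *\<^sub>R z + (1 - r) *\<^sub>R q)"
        using r(4) by simp
      finally show ?thesis
        by (simp add: scaleR_right_distrib mult.assoc mult.commute mult.left_commute)
    qed
    define c1 c2 where "c1 = (1 - s) * r * (1 - t)" and "c2 = s * t * (1 - r)"
    have c: "0 \<le> c1" "0 \<le> c2"
      unfolding c1_def c2_def using s t r by (auto intro!: mult_nonneg_nonneg)
    have Dc: "D = r * t + c1 + c2"
      by (simp add: c1_def c2_def D_def algebra_simps)
    have rt: "0 < r * t" using r t by simp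
    show "?m \<in> minimal_face P x"
    proof (cases "c1 + c2 = 0")
      case True
      then have "c1 = 0" "c2 = 0" "D = r * t"
        using c Dc by auto
      then have "D *\<^sub>R x = D *\<^sub>R ?m"
        using eq by (simp flip: c1_def c2_def)
      then have "x = ?m"
        using D by simp
      then show ?thesis
        unfolding minimal_face_def using yP by (auto intro!: exI[of _ "1::real"])
    next
      case False
      define w where "w = (c1 / (c1 + c2)) *\<^sub>R p + (c2 / (c1 + c2)) *\<^sub>R q"
      have wP: "w \<in> P"
        unfolding w_def using c False
        by (intro convexD[OF assms(1) t(3) r(3)]) (auto simp flip: add_divide_distrib)
      have w: "(c1 + c2) *\<^sub>R w = c1 *\<^sub>R p + c2 *\<^sub>R q"
        using False by (simp add: w_def scaleR_right_distrib)
      have "x = (1 / D) *\<^sub>R (D *\<^sub>R x)"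
        using D by simp
      also have "\<dots> = (1 / D) *\<^sub>R ((r * t) *\<^sub>R ?m + (c1 + c2) *\<^sub>R w)"
        using eq w by (simp add: add.assoc flip: c1_def c2_def)
      also have "\<dots> = (r * t / D) *\<^sub>R ?m + ((c1 + c2) / D) *\<^sub>R w"
        by (simp add: scaleR_right_distrib)
      also have "(c1 + c2) / D = 1 - r * t / D"
        using D Dc by (simp add: field_simps)
      finally have "x = (r * t / D) *\<^sub>R ?m + (1 - r * t / D) *\<^sub>R w" .
      moreover have "0 < r * t / D" "r * t / D \<le> 1"
        using rt D by auto
      ultimately show ?thesis
        unfolding minimal_face_def using yP wP by blast
    qed
  qed
  moreover have "a \<in> minimal_face P x \<and> b \<in> minimal_face P x"
    if "a \<in> P" "b \<in> P" "y \<in> minimal_face P x" "y \<in> open_segment a b" for a b y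
  proof -
    obtain s where s: "0 < s" "s < 1" "y = (1 - s) *\<^sub>R a + s *\<^sub>R b"
      using \<open>y \<in> open_segment a b\<close> by (auto simp: in_segment)
    then show ?thesis
      using absorb[of "1 - s" a b] absorb[of s b a] that by (simp add: add.commute)
  qed
  moreover have "minimal_face P x \<subseteq> P"
    by (auto simp: minimal_face_def)
  ultimately show ?thesis
    unfolding face_of_def by blast
qed

text \<open>Every face through \<open>x\<close> absorbs each point \<open>y\<close> that occurs in a
  combination for \<open>x\<close>.\<close>

lemma inner_point_minimal_face:
  assumes "x \<in> P"
  shows "inner_point P (minimal_face P x) x"
proof -
  have "x \<in> minimal_face P x"
    unfolding minimal_face_def using assms by (auto intro!: exI[of _ "1::real"])
  moreover have "y \<in> F" if "F face_of P" "x \<in> F" "y \<in> minimal_face P x" for F y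
    using that face_of_combinationD[OF that(1)] unfolding minimal_face_def by blast
  ultimately show ?thesis
    unfolding inner_point_def by blast
qed

section \<open>The face lattice of a hyperplane section\<close>

text \<open>The faces whose relative interior meets \<open>H\<close>. For a polytope and an affine
  \<open>H\<close> they index the nonempty faces of the section.\<close>

definition cut_faces :: "'a::real_vector set \<Rightarrow> 'a set \<Rightarrow> 'a set set" where
  "cut_faces P H = {F. F face_of P \<and> (\<exists>x\<in>H. inner_point P F x)}"

text \<open>The face sought is a maximal one among the minimal faces of the points of
  \<open>G\<close>; it exists because a polytope has finitely many faces.\<close>

lemma face_of_section:
  fixes V :: "'a::real_vector set"
  assumes "finite V" "affine H" "G face_of (convex hull V) \<inter> H" "G \<noteq> {}"
  shows "\<exists>F \<in> cut_faces (convex hull V) H. F \<inter> H = G"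
proof -
  let ?P = "convex hull V"
  have GP: "G \<subseteq> ?P" "G \<subseteq> H"
    using face_of_imp_subset[OF assms(3)] by auto
  have mf: "minimal_face ?P x face_of ?P" if "x \<in> G" for x
    using minimal_face_of GP that by (metis convex_convex_hull subsetD)
  have "finite (minimal_face ?P ` G)"
    using finite_subset[OF _ finite_faces_of_convex_hull[OF assms(1)]] mf by blast
  then obtain F where F: "F \<in> minimal_face ?P ` G"
    and max: "\<And>F'. F' \<in> minimal_face ?P ` G \<Longrightarrow> F \<subseteq> F' \<Longrightarrow> F' = F"
    using finite_has_maximal[of "minimal_face ?P ` G"] assms(4) by (metis image_is_empty)
  obtain x where x: "x \<in> G" "F = minimal_face ?P x"
    using F by blast
  have inner: "inner_point ?P F x"
    using inner_point_minimal_face x GP by blast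
  have "y \<in> F" if y: "y \<in> G" for y
  proof -
    \<comment> \<open>The minimal face of the midpoint contains \<open>x\<close> and
      \<open>y\<close>, hence contains \<open>F\<close>, and by maximality it equals
      \<open>F\<close>.\<close>
    define z where "z = (1/2) *\<^sub>R x + (1 - 1/2) *\<^sub>R y"
    have zG: "z \<in> G"
      unfolding z_def using face_of_imp_convex[OF assms(3)] x(1) y
      by (intro convexD) auto
    have zz: "z \<in> minimal_face ?P z"
      using inner_point_minimal_face[of z ?P] zG GP unfolding inner_point_def by blast
    have "x \<in> minimal_face ?P z"
      using face_of_combinationD[OF mf[OF zG], of x y "1/2"] zz x(1) y GP
      by (auto simp: z_def)
    then have "F \<subseteq> minimal_face ?P z"
      using inner mf[OF zG] unfolding inner_point_def by blast
    then have "minimal_face ?P z = F"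
      using max zG by blast
    moreover have "y \<in> minimal_face ?P z"
      using face_of_combinationD[OF mf[OF zG], of y x "1/2"] zz x(1) y GP
      by (auto simp: z_def add.commute)
    ultimately show ?thesis by simp
  qed
  moreover have "y \<in> G" if y: "y \<in> F" "y \<in> H" for y
  proof -
    obtain t q where t: "0 < t" "t \<le> 1" "q \<in> ?P" "x = t *\<^sub>R y + (1 - t) *\<^sub>R q" "y \<in> ?P"
      using y(1) unfolding x(2) minimal_face_def by blast
    show ?thesis
    proof (cases "t = 1")
      case True
      then show ?thesis using t x by simp
    next
      case False
      \<comment> \<open>\<open>q\<close> is on the line through \<open>x\<close> and
        \<open>y\<close>, hence in the affine set \<open>H\<close>; so \<open>y\<close> and
        \<open>q\<close> lie in the section and its face \<open>G\<close> absorbs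
        \<open>y\<close>.\<close>
      have "(1 / (1 - t)) *\<^sub>R x + (- t / (1 - t)) *\<^sub>R y \<in> H"
      proof (rule mem_affine[OF assms(2)])
        show "x \<in> H" using x GP by blast
        show "1 / (1 - t) + - t / (1 - t) = 1" using False by (simp add: field_simps)
      qed (rule y(2))
      also have "(1 / (1 - t)) *\<^sub>R x + (- t / (1 - t)) *\<^sub>R y = q"
        using False by (simp add: t(4) scaleR_right_distrib)
      finally show ?thesis
        using face_of_combinationD[OF assms(3), of y q t] t y(2) x(1) by simp
    qed
  qed
  ultimately have "F \<inter> H = G"
    using GP by blast
  then show ?thesis
    using inner x mf GP unfolding cut_faces_def by blast
qed

text \<open>Order is reflected because an inner point of \<open>F\<close> in \<open>H\<close> that
  lies in \<open>F'\<close> forces all of \<open>F\<close> into \<open>F'\<close>. The empty set is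
  added by hand: a cut face contains a point of \<open>H\<close>, so none yields the empty face of
  the section.\<close>

lemma cut_faces_order_isomorphism:
  fixes V :: "'a::real_vector set"
  assumes "finite V" "affine H"
  defines "P \<equiv> convex hull V"
  shows "bij_betw (\<lambda>F. F \<inter> H) (insert {} (cut_faces P H)) (face_lattice (P \<inter> H))"
    and "\<forall>F \<in> insert {} (cut_faces P H). \<forall>F' \<in> insert {} (cut_faces P H).
      F \<subseteq> F' \<longleftrightarrow> F \<inter> H \<subseteq> F' \<inter> H"
proof -
  have ord: "F \<subseteq> F' \<longleftrightarrow> F \<inter> H \<subseteq> F' \<inter> H"
    if "F \<in> insert {} (cut_faces P H)" "F' \<in> insert {} (cut_faces P H)" for F F'
    using that unfolding cut_faces_def inner_point_def by blast
  then show "\<forall>F \<in> insert {} (cut_faces P H). \<forall>F' \<in> insert {} (cut_faces P H).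
      F \<subseteq> F' \<longleftrightarrow> F \<inter> H \<subseteq> F' \<inter> H"
    by simp
  have "inj_on (\<lambda>F. F \<inter> H) (insert {} (cut_faces P H))"
    unfolding inj_on_def using ord by (metis order_antisym order_refl)
  moreover have "(\<lambda>F. F \<inter> H) ` insert {} (cut_faces P H) = face_lattice (P \<inter> H)"
  proof
    show "(\<lambda>F. F \<inter> H) ` insert {} (cut_faces P H) \<subseteq> face_lattice (P \<inter> H)"
      using face_of_slice affine_imp_convex[OF assms(2)]
      unfolding cut_faces_def face_lattice_def by auto
    show "face_lattice (P \<inter> H) \<subseteq> (\<lambda>F. F \<inter> H) ` insert {} (cut_faces P H)"
      using face_of_section[OF assms(1,2)] unfolding face_lattice_def P_def by fastforce
  qed
  ultimately show "bij_betw (\<lambda>F. F \<inter> H) (insert {} (cut_faces P H)) (face_lattice (P \<inter> H))"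
    unfolding bij_betw_def by blast
qed

section \<open>Isomorphisms of face lattices and equality of combinatorial types\<close>

lemma order_isomorphism_span:
  assumes "bij_betw f T A" "\<forall>x\<in>T. \<forall>y\<in>T. x \<subseteq> y \<longleftrightarrow> f x \<subseteq> f y"
    and "bij_betw g T B" "\<forall>x\<in>T. \<forall>y\<in>T. x \<subseteq> y \<longleftrightarrow> g x \<subseteq> g y"
  shows "\<exists>h. bij_betw h A B \<and> (\<forall>x\<in>A. \<forall>y\<in>A. x \<subseteq> y \<longleftrightarrow> h x \<subseteq> h y)"
proof (intro exI conjI ballI)
  \<comment> \<open>Both maps start from the common index set \<open>T\<close>, so \<open>h\<close>
    goes back along \<open>f\<close> and forward along \<open>g\<close>.\<close>
  let ?i = "inv_into T f"
  have i: "bij_betw ?i A T"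
    by (rule bij_betw_inv_into[OF assms(1)])
  then show "bij_betw (g \<circ> ?i) A B"
    using assms(3) by (rule bij_betw_trans)
  fix x y assume xy: "x \<in> A" "y \<in> A"
  then have "?i x \<in> T" "?i y \<in> T" "f (?i x) = x" "f (?i y) = y"
    using i assms(1) bij_betwE bij_betw_inv_into_right by metis+
  then show "x \<subseteq> y \<longleftrightarrow> (g \<circ> ?i) x \<subseteq> (g \<circ> ?i) y"
    using assms(2,4) by (metis comp_apply)
qed

lemma face_lattice_isomorphic_sym:
  assumes "face_lattice_isomorphic P Q"
  shows "face_lattice_isomorphic Q P"
proof -
  obtain f where f: "bij_betw f (face_lattice P) (face_lattice Q) \<and>
      (\<forall>F \<in> face_lattice P. \<forall>G \<in> face_lattice P. F \<subseteq> G \<longleftrightarrow> f F \<subseteq> f G)"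
    using assms unfolding face_lattice_isomorphic_def by (rule exE)
  \<comment> \<open>With the identity as second map, the construction inverts
    \<open>f\<close>.\<close>
  from order_isomorphism_span[OF conjunct1[OF f] conjunct2[OF f] bij_betw_id] show ?thesis
    unfolding face_lattice_isomorphic_def by simp
qed

lemma face_lattice_isomorphic_trans:
  assumes "face_lattice_isomorphic P Q" "face_lattice_isomorphic Q R"
  shows "face_lattice_isomorphic P R"
proof -
  obtain f where f: "bij_betw f (face_lattice Q) (face_lattice P) \<and>
      (\<forall>F \<in> face_lattice Q. \<forall>G \<in> face_lattice Q. F \<subseteq> G \<longleftrightarrow> f F \<subseteq> f G)"
    using face_lattice_isomorphic_sym[OF assms(1)] unfolding face_lattice_isomorphic_def by (rule exE)
  obtain g where g: "bij_betw g (face_lattice Q) (face_lattice R) \<and>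
      (\<forall>F \<in> face_lattice Q. \<forall>G \<in> face_lattice Q. F \<subseteq> G \<longleftrightarrow> g F \<subseteq> g G)"
    using assms(2) unfolding face_lattice_isomorphic_def by (rule exE)
  show ?thesis
    unfolding face_lattice_isomorphic_def
    by (rule order_isomorphism_span[OF conjunct1[OF f] conjunct2[OF f] conjunct1[OF g] conjunct2[OF g]])
qed

lemma combinatorial_type_eq:
  assumes "face_lattice_isomorphic P Q"
  shows "combinatorial_type P = combinatorial_type Q"
  unfolding combinatorial_type_def
  using assms face_lattice_isomorphic_sym face_lattice_isomorphic_trans by blast

section \<open>Which faces of a polytope a hyperplane cuts\<close>

lemma inner_point_exists:
  fixes V :: "'a::real_vector set"
  assumes "finite V" "F face_of convex hull V" "F \<noteq> {}"
  shows "\<exists>c. inner_point (convex hull V) F c"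
proof -
  let ?W = "V \<inter> F"
  have W: "finite ?W" "F = convex hull ?W"
    using face_of_convex_hull_generators[OF assms(1,2)] assms(1) by auto
  then have "?W \<noteq> {}"
    using assms(3) by force
  \<comment> \<open>The barycentre of the generators in \<open>F\<close> gives each of them positive
    weight, so a face through it absorbs them all.\<close>
  define u where "u v = 1 / real (card ?W)" for v :: 'a
  have cW: "card ?W > 0"
    using W(1) \<open>?W \<noteq> {}\<close> by (simp add: card_gt_0_iff)
  have u: "0 < u v" "sum u ?W = 1" for v
    using cW by (auto simp: u_def)
  let ?c = "\<Sum>v\<in>?W. u v *\<^sub>R v"
  have "?c \<in> F"
  proof (rule convex_sum)
    show "convex F"
      by (rule face_of_imp_convex[OF assms(2)])
  qed (use W u less_imp_le in auto)
  moreover have "F \<subseteq> F'" if F': "F' face_of convex hull V" "?c \<in> F'" for F'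
  proof -
    have "w \<in> F'" if w: "w \<in> ?W" for w
    proof -
      obtain q where q: "q \<in> convex hull ?W" "?c = u w *\<^sub>R w + (1 - u w) *\<^sub>R q" "u w \<le> 1"
        using convex_combination_split[OF W(1) _ u(2) w] u(1) less_imp_le by blast
      have "w \<in> convex hull V" "q \<in> convex hull V"
        using w q(1) hull_mono[of ?W V] by (auto simp: hull_inc)
      then show ?thesis
        using face_of_combinationD[OF F'(1) _ _ u(1) q(3)] q(2) F'(2) by simp
    qed
    then show ?thesis
      using W(2) hull_minimal[of ?W F' convex] face_of_imp_convex[OF F'(1)] by blast
  qed
  ultimately show ?thesis
    unfolding inner_point_def by blast
qed

text \<open>A face containing the new point absorbs \<open>c\<close>, as \<open>t\<close> is
  positive, and hence contains \<open>F\<close>. This lets an inner point slide along a segment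
  until it reaches the hyperplane.\<close>

lemma inner_point_combination:
  fixes P :: "'a::real_vector set"
  assumes "F face_of P" "inner_point P F c" "w \<in> F" "0 < t" "t \<le> 1"
  shows "inner_point P F (t *\<^sub>R c + (1 - t) *\<^sub>R w)"
proof -
  have cw: "c \<in> F" "F \<subseteq> P"
    using assms(1,2) face_of_imp_subset unfolding inner_point_def by auto
  have "t *\<^sub>R c + (1 - t) *\<^sub>R w \<in> F"
    using convexD[OF face_of_imp_convex[OF assms(1)] cw(1) assms(3)] assms by simp
  moreover have "F \<subseteq> F'" if "F' face_of P" "t *\<^sub>R c + (1 - t) *\<^sub>R w \<in> F'" for F'
    using face_of_combinationD[OF that(1) _ _ assms(4,5) that(2)] cw assms(2,3) that(1)
    unfolding inner_point_def by blast
  ultimately show ?thesis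
    unfolding inner_point_def by blast
qed

lemma face_of_supporting_linear:
  fixes l :: "'a::real_vector \<Rightarrow> real"
  assumes "linear l" "convex F" "\<And>x. x \<in> F \<Longrightarrow> b \<le> l x"
  shows "F \<inter> {x. l x = b} face_of F"
proof -
  have "convex {x. l x = b}"
    using assms(1) by (auto simp: convex_def linear_add linear_cmul simp flip: distrib_right)
  moreover have "l y = b \<and> l z = b"
    if "y \<in> F" "z \<in> F" "x \<in> open_segment y z" "l x = b" for x y z
  proof -
    obtain s where s: "0 < s" "s < 1" "x = (1 - s) *\<^sub>R y + s *\<^sub>R z"
      using \<open>x \<in> open_segment y z\<close> by (auto simp: in_segment)
    then have "l x = (1 - s) * l y + s * l z"
      by (simp only: linear_add[OF assms(1)] linear_cmul[OF assms(1)] real_scaleR_def)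
    then have "(1 - s) * (l y - b) + s * (l z - b) = 0"
      using \<open>l x = b\<close> by (simp add: algebra_simps)
    moreover have "0 \<le> (1 - s) * (l y - b)" "0 \<le> s * (l z - b)"
      using s assms(3) that by auto
    ultimately have "(1 - s) * (l y - b) = 0" "s * (l z - b) = 0"
      by linarith+
    then show ?thesis
      using s by simp
  qed
  ultimately show ?thesis
    using assms(2) unfolding face_of_def by (auto intro: convex_Int)
qed

text \<open>Otherwise \<open>l\<close> attains its minimum \<open>b\<close> over \<open>F\<close> at
  the inner point \<open>x\<close>; the points of \<open>F\<close> with \<open>l = b\<close> then
  form a face of \<open>P\<close> through \<open>x\<close>, which must be all of \<open>F\<close>,
  against \<open>b < l v\<close>.\<close>

lemma cut_face_two_sided:
  fixes l :: "'a::real_vector \<Rightarrow> real"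
  assumes "linear l" "F face_of P" "inner_point P F x" "l x = b" "v \<in> F" "b < l v"
  shows "\<exists>w\<in>F. l w < b"
proof (rule ccontr)
  assume "\<not> ?thesis"
  then have "F \<inter> {x. l x = b} face_of F"
    using assms(2) by (intro face_of_supporting_linear[OF assms(1)]) (auto simp: face_of_imp_convex)
  then have "F \<subseteq> F \<inter> {x. l x = b}"
    using assms(2-4) face_of_trans unfolding inner_point_def by blast
  then show False
    using assms(5,6) by auto
qed

text \<open>The equivalence on the right packs two cases: \<open>F\<close> has points strictly on
  both sides, or \<open>l\<close> is constantly \<open>b\<close> on \<open>F\<close>. One direction
  uses \<open>cut_face_two_sided\<close> for \<open>l\<close> and \<open>- l\<close>, the other
  slides an inner point onto the hyperplane.\<close>

lemma cut_faces_hyperplane: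
  fixes V :: "'a::real_vector set" and l :: "'a \<Rightarrow> real"
  assumes "finite V" "linear l"
  shows "F \<in> cut_faces (convex hull V) {x. l x = b} \<longleftrightarrow>
    F face_of convex hull V \<and> F \<noteq> {} \<and> ((\<exists>v\<in>F. b < l v) \<longleftrightarrow> (\<exists>v\<in>F. l v < b))"
    (is "_ \<longleftrightarrow> ?R")
proof
  assume "F \<in> cut_faces (convex hull V) {x. l x = b}"
  then obtain x where x: "F face_of convex hull V" "l x = b" "inner_point (convex hull V) F x"
    unfolding cut_faces_def by blast
  have "linear (\<lambda>x. - l x)"
    using assms(2) by (rule linear_compose_neg)
  then show ?R
    using cut_face_two_sided[OF assms(2) x(1,3,2)] cut_face_two_sided[of "\<lambda>x. - l x", OF _ x(1,3)] x
    unfolding inner_point_def by fastforce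
next
  assume R: ?R
  then have F: "F face_of convex hull V" and ne: "F \<noteq> {}"
    by auto
  obtain c where c: "inner_point (convex hull V) F c"
    using inner_point_exists[OF assms(1) F ne] by blast
  then have cF: "c \<in> F"
    by (simp add: inner_point_def)
  \<comment> \<open>\<open>w\<close> lies strictly opposite to \<open>c\<close>; if \<open>c\<close>
    is already on the hyperplane, \<open>w = c\<close> is a default.\<close>
  obtain w where w: "w \<in> F" "l c = b \<or> l c < b \<and> b < l w \<or> b < l c \<and> l w < b"
  proof (cases "l c" b rule: linorder_cases)
    case less
    then show ?thesis using R cF that by blast
  next
    case equal
    then show ?thesis using cF that by blast
  next
    case greater
    then show ?thesis using R cF that by blast
  qed
  have "\<exists>t. 0 < t \<and> t \<le> 1 \<and> t * l c + (1 - t) * l w = b"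
  proof (cases "l c = b")
    case True
    then show ?thesis by (intro exI[of _ 1]) simp
  next
    case False
    then show ?thesis
      \<comment> \<open>This \<open>t\<close> solves the linear equation; it lies strictly between 0
        and 1 because \<open>b\<close> separates \<open>l c\<close> from \<open>l w\<close>.\<close>
      using w(2) by (intro exI[of _ "(b - l w) / (l c - l w)"]) (auto simp: field_simps)
  qed
  then obtain t where t: "0 < t" "t \<le> 1" "t * l c + (1 - t) * l w = b"
    by blast
  have "l (t *\<^sub>R c + (1 - t) *\<^sub>R w) = b"
    using assms(2) t(3) by (simp add: linear_add linear_cmul)
  then show "F \<in> cut_faces (convex hull V) {x. l x = b}"
    using inner_point_combination[OF F c w(1) t(1,2)] F unfolding cut_faces_def by blast
qed

text \<open>The half-space \<open>l <= b\<close> is convex, so it contains the hull once it contains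
  the generators. This reduces conditions on a face to its generators.\<close>

lemma convex_hull_linear_gt_iff:
  fixes l :: "'a::real_vector \<Rightarrow> real"
  assumes "linear l"
  shows "(\<exists>x\<in>convex hull W. b < l x) \<longleftrightarrow> (\<exists>x\<in>W. b < l x)"
proof
  assume "\<exists>x\<in>convex hull W. b < l x"
  moreover have "convex {x. l x \<le> b}"
    using assms convex_linear_vimage[of l "{..b}"] by (simp add: vimage_def)
  then have "convex hull W \<subseteq> {x. l x \<le> b}" if "W \<subseteq> {x. l x \<le> b}"
    using that by (simp add: hull_minimal)
  ultimately show "\<exists>x\<in>W. b < l x"
    by fastforce
qed (auto simp: hull_inc)

text \<open>Whether a face is cut depends only on the sides occupied by its generators. Equal signs
  therefore give equal sets of cut faces, and both section lattices are indexed by the same ordered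
  set.\<close>

lemma section_isomorphic:
  fixes V :: "'a::real_vector set" and l l' :: "'a \<Rightarrow> real"
  assumes "finite V" "linear l" "linear l'"
    and sgn: "\<And>v. v \<in> V \<Longrightarrow> sgn (l v - b) = sgn (l' v - b')"
  shows "face_lattice_isomorphic (convex hull V \<inter> {x. l x = b}) (convex hull V \<inter> {x. l' x = b'})"
proof -
  let ?P = "convex hull V"
  have side: "((\<exists>v\<in>F. b < l v) \<longleftrightarrow> (\<exists>v\<in>F. b' < l' v)) \<and> ((\<exists>v\<in>F. l v < b) \<longleftrightarrow> (\<exists>v\<in>F. l' v < b'))"
    if "F face_of ?P" for F
  proof -
    have F: "F = convex hull (V \<inter> F)"
      by (rule face_of_convex_hull_generators[OF assms(1) that])
    have gt: "(b < l v \<longleftrightarrow> b' < l' v) \<and> (l v < b \<longleftrightarrow> l' v < b')" if "v \<in> V" for v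
      using sgn[OF that] by (auto simp: sgn_if split: if_splits)
    have neg: "linear (\<lambda>x. - l x)" "linear (\<lambda>x. - l' x)"
      using assms(2,3) by (auto intro: linear_compose_neg)
    have "(\<exists>v\<in>F. b < l v) \<longleftrightarrow> (\<exists>v\<in>V \<inter> F. b < l v)" "(\<exists>v\<in>F. b' < l' v) \<longleftrightarrow> (\<exists>v\<in>V \<inter> F. b' < l' v)"
      using convex_hull_linear_gt_iff[OF assms(2), of "V \<inter> F" b]
        convex_hull_linear_gt_iff[OF assms(3), of "V \<inter> F" b'] F by auto
    moreover have "(\<exists>v\<in>F. l v < b) \<longleftrightarrow> (\<exists>v\<in>V \<inter> F. l v < b)" "(\<exists>v\<in>F. l' v < b') \<longleftrightarrow> (\<exists>v\<in>V \<inter> F. l' v < b')"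
      using convex_hull_linear_gt_iff[OF neg(1), of "V \<inter> F" "- b"]
        convex_hull_linear_gt_iff[OF neg(2), of "V \<inter> F" "- b'"] F by auto
    ultimately show ?thesis
      using gt by blast
  qed
  have "F \<in> cut_faces ?P {x. l x = b} \<longleftrightarrow> F \<in> cut_faces ?P {x. l' x = b'}" for F
    unfolding cut_faces_hyperplane[OF assms(1,2)] cut_faces_hyperplane[OF assms(1,3)]
    by (cases "F face_of ?P") (simp_all add: side)
  then have eq: "cut_faces ?P {x. l x = b} = cut_faces ?P {x. l' x = b'}"
    by (rule set_eqI)
  have aff: "affine {x. f x = c}" if "linear f" for f :: "'a \<Rightarrow> real" and c
    using that by (auto simp: affine_def linear_add linear_cmul simp flip: distrib_right)
  show ?thesis
    unfolding face_lattice_isomorphic_def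
    by (rule order_isomorphism_span[OF cut_faces_order_isomorphism[OF assms(1) aff[OF assms(2), of b]]
          cut_faces_order_isomorphism[OF assms(1) aff[OF assms(3), of b'], folded eq]])
qed

section \<open>Counting section types\<close>

lemma lookup_scaleR [simp]:
  fixes x :: "'i \<Rightarrow>\<^sub>0 'a::real_vector"
  shows "Poly_Mapping.lookup (r *\<^sub>R x) i = r *\<^sub>R Poly_Mapping.lookup x i"
proof -
  have "finite {i. r *\<^sub>R Poly_Mapping.lookup x i \<noteq> 0}"
    by (rule finite_subset[of _ "{i. Poly_Mapping.lookup x i \<noteq> 0}"]) auto
  then show ?thesis
    by (simp add: scaleR_poly_mapping_def)
qed

definition coord_inner :: "nat \<Rightarrow> (nat \<Rightarrow>\<^sub>0 real) \<Rightarrow> (nat \<Rightarrow>\<^sub>0 real) \<Rightarrow> real" where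
  "coord_inner d a x = (\<Sum>i<d. Poly_Mapping.lookup a i * Poly_Mapping.lookup x i)"

lemma linear_coord_inner: "linear (coord_inner d a)"
  by (rule linearI)
    (simp_all add: coord_inner_def lookup_add distrib_left sum.distrib sum_distrib_left mult.left_commute)

lemma coord_inner_commute: "coord_inner d a x = coord_inner d x a"
  by (simp add: coord_inner_def mult.commute)

text \<open>Duality: the point \<open>v\<close> is fixed and the hyperplane \<open>(a, b)\<close>
  varies, so each vertex becomes a linear functional on the parameter space.\<close>

lemma linear_hyperplane_evaluation:
  "linear (\<lambda>(a, b). coord_inner d a v - b)"
  by (rule linearI)
    (auto simp: coord_inner_commute[of d _ v] linear_add[OF linear_coord_inner]
      linear_cmul[OF linear_coord_inner] algebra_simps)

text \<open>One generator for each of the \<open>d\<close> coordinates of the normal and one for the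
  offset: the source of the exponent \<open>d + 1\<close>.\<close>

lemma Rspace_Times_span:
  obtains B :: "((nat \<Rightarrow>\<^sub>0 real) \<times> real) set"
  where "finite B" "card B \<le> d + 1" "Rspace d \<times> UNIV \<subseteq> span B"
proof -
  let ?e = "\<lambda>i. (Poly_Mapping.single i 1 :: nat \<Rightarrow>\<^sub>0 real, 0::real)"
  define B where "B = insert (0, 1) (?e ` {..<d})"
  have "card B \<le> Suc (card (?e ` {..<d}))"
    by (simp add: B_def card_insert_if)
  also have "\<dots> \<le> d + 1"
    using card_image_le[of "{..<d}" ?e] by simp
  finally have "card B \<le> d + 1" .
  moreover have "(a, b) \<in> span B" if "a \<in> Rspace d" for a b
  proof -
    have "(\<Sum>i<d. Poly_Mapping.lookup a i *\<^sub>R Poly_Mapping.single i (1::real)) = a"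
    proof (rule poly_mapping_eqI)
      fix k
      have "Poly_Mapping.lookup a k = 0" if "\<not> k < d"
        using \<open>a \<in> Rspace d\<close> that by (auto simp: Rspace_def in_keys_iff subset_iff)
      then show "Poly_Mapping.lookup (\<Sum>i<d. Poly_Mapping.lookup a i *\<^sub>R Poly_Mapping.single i (1::real)) k =
          Poly_Mapping.lookup a k"
        by (cases "k < d") (simp_all add: lookup_sum lookup_single when_def if_distrib cong: if_cong)
    qed
    then have "(a, b) = (\<Sum>i<d. Poly_Mapping.lookup a i *\<^sub>R ?e i) + b *\<^sub>R (0, 1)"
      by (simp add: sum_prod)
    also have "\<dots> \<in> span B"
      by (intro span_add span_sum span_scale span_base) (auto simp: B_def)
    finally show ?thesis .
  qed
  ultimately show thesis
    using that[of B] by (auto simp: B_def)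
qed

lemma card_image_le_if_factors:
  assumes "finite (g ` A)" "\<And>x y. x \<in> A \<Longrightarrow> y \<in> A \<Longrightarrow> g x = g y \<Longrightarrow> f x = f y"
  shows "finite (f ` A) \<and> card (f ` A) \<le> card (g ` A)"
proof -
  have "f ` A = (\<lambda>s. f (inv_into A g s)) ` g ` A"
    unfolding image_image
    by (rule image_cong[OF refl], rule assms(2)) (simp_all add: inv_into_into f_inv_into_f)
  then show ?thesis
    using assms(1) by (metis card_image_le finite_imageI)
qed

text \<open>The section type is a function of the signs of the vertex functionals at
  \<open>(a, b)\<close>, so there are no more types than sign patterns on the parameter
  space.\<close>

lemma section_types_card_bound:
  assumes "polytope P" "P \<subseteq> Rspace d" "P \<noteq> {}"
  shows "finite (section_types d P) \<and>
    card (section_types d P) \<le> 2 * (2 * card (vertices P)) ^ (d + 1)"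
proof -
  let ?V = "vertices P"
  have V: "finite ?V" "P = convex hull ?V"
    using polytope_convex_hull_vertices[OF assms(1)] by auto
  then have ne: "?V \<noteq> {}"
    using assms(3) by force
  define g where "g v = (\<lambda>(a, b). coord_inner d a v - b)" for v
  define A where "A = {ab :: (nat \<Rightarrow>\<^sub>0 real) \<times> real. fst ab \<in> Rspace d \<and> fst ab \<noteq> 0}"
  define f where "f ab = combinatorial_type (P \<inter> {x. coord_inner d (fst ab) x = snd ab})"
    for ab :: "(nat \<Rightarrow>\<^sub>0 real) \<times> real"
  obtain B :: "((nat \<Rightarrow>\<^sub>0 real) \<times> real) set"
    where B: "finite B" "card B \<le> d + 1" "Rspace d \<times> UNIV \<subseteq> span B"
    by (rule Rspace_Times_span)
  have lin: "linear (g v)" for v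
    unfolding g_def by (rule linear_hyperplane_evaluation)
  have S: "finite (sign_pattern g ?V ` span B)"
    "card (sign_pattern g ?V ` span B) \<le> 2 * (2 * card ?V) ^ (d + 1)"
    using sign_pattern_card_bound[OF V(1) ne lin B(1,2)] by auto
  \<comment> \<open>Pairs with nonzero normal do not form a subspace; the patterns are counted on a
    whole span containing them.\<close>
  have sub: "sign_pattern g ?V ` A \<subseteq> sign_pattern g ?V ` span B"
    using B(3) unfolding A_def by (intro image_mono) auto
  \<comment> \<open>Since \<open>P\<close> lies in \<open>Rspace d\<close>, the section equals that
    by the full level set of a linear functional, the form required by
    \<open>section_isomorphic\<close>.\<close>
  have f_eq: "combinatorial_type (P \<inter> {x \<in> Rspace d.
      (\<Sum>i<d. Poly_Mapping.lookup a i * Poly_Mapping.lookup x i) = b}) = f (a, b)" for a b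
    unfolding f_def using assms(2)
    by (intro arg_cong[where f = combinatorial_type]) (auto simp: coord_inner_def)
  have "section_types d P = {f (a, b) | a b. a \<in> Rspace d \<and> a \<noteq> 0}"
    unfolding section_types_def affine_hyperplane_def f_eq[symmetric] by blast
  also have "\<dots> = f ` A"
    unfolding A_def by (auto simp: image_iff)
  finally have "section_types d P = f ` A" .
  moreover have "f x = f y" if "x \<in> A" "y \<in> A" "sign_pattern g ?V x = sign_pattern g ?V y" for x y
  proof -
    have "sgn (coord_inner d (fst x) v - snd x) = sgn (coord_inner d (fst y) v - snd y)"
      if "v \<in> ?V" for v
      using \<open>sign_pattern g ?V x = _\<close> that by (auto simp: sign_pattern_eq_iff g_def split_beta)
    from section_isomorphic[OF V(1) linear_coord_inner linear_coord_inner this]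
    show ?thesis
      unfolding f_def using V(2) combinatorial_type_eq by metis
  qed
  ultimately have "finite (section_types d P) \<and> card (section_types d P) \<le> card (sign_pattern g ?V ` A)"
    using card_image_le_if_factors[of "sign_pattern g ?V" A f] finite_subset[OF sub S(1)] by metis
  then show ?thesis
    using card_mono[OF S(1) sub] S(2) by linarith
qed

theorem theorem1p2:
  shows "\<exists>C::real. \<forall>(d::nat) (n::nat) (P :: (nat \<Rightarrow>\<^sub>0 real) set).
    polytope P \<longrightarrow> P \<subseteq> Rspace d \<longrightarrow> has_aff_dim P d \<longrightarrow> card (vertices P) = n \<longrightarrow>
      finite (section_types d P) \<and>
      real (card (section_types d P)) \<le> C * (real n ^ (2 * d + 1) * 2 ^ d)"
proof (intro exI[of _ 4] allI impI)
  fix d n :: nat and P :: "(nat \<Rightarrow>\<^sub>0 real) set"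
  assume P: "polytope P" "P \<subseteq> Rspace d" "has_aff_dim P d" "card (vertices P) = n"
  \<comment> \<open>An affine basis with \<open>d + 1\<close> points is nonempty, so
    \<open>P\<close> cannot have the affine hull of the empty set.\<close>
  have ne: "P \<noteq> {}"
    using P(3) by (auto simp: has_aff_dim_def)
  have "vertices P \<noteq> {}"
    using polytope_convex_hull_vertices(2)[OF P(1)] ne by force
  then have n: "1 \<le> n"
    using P(4) polytope_convex_hull_vertices(1)[OF P(1)] by (metis One_nat_def Suc_leI card_gt_0_iff)
  have bound: "finite (section_types d P)" "card (section_types d P) \<le> 2 * (2 * n) ^ (d + 1)"
    using section_types_card_bound[OF P(1,2) ne] P(4) by auto
  \<comment> \<open>The constant 4 collects the leading 2 and one factor 2 of the power.\<close>
  have "2 * (2 * n) ^ (d + 1) = 4 * (n ^ (d + 1) * 2 ^ d)"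
    by (simp add: power_mult_distrib)
  \<comment> \<open>Raising the exponent from \<open>d + 1\<close> to \<open>2 * d + 1\<close> is
    sound because \<open>n\<close> is at least 1.\<close>
  also have "\<dots> \<le> 4 * (n ^ (2 * d + 1) * 2 ^ d)"
    using n by (intro mult_left_mono mult_right_mono power_increasing) auto
  finally have "real (card (section_types d P)) \<le> real (4 * (n ^ (2 * d + 1) * 2 ^ d))"
    using bound(2) by (meson of_nat_le_iff order_trans)
  then show "finite (section_types d P) \<and>
      real (card (section_types d P)) \<le> 4 * (real n ^ (2 * d + 1) * 2 ^ d)"
    using bound(1) by simp
qed

end
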